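(* For every $\varepsilon>0$ and every integer $k\ge 2$, there exists a $C_{2k}$-free graph $G$ such that every subgraph of $G$ that is both bipartite and $C_4$-free has at most $\left(1-\frac{1}{2^{k-1}}\right)\frac{1}{k-1}\,e(G)\,(1+\varepsilon)$ edges.
   Context: $e(G)$ denotes the number of edges of a graph $G$. A graph is $C_{t}$-free if it contains no cycle of length $t$ as a subgraph. *)

theory Defs
  imports Complex_Main
begin

definition simple_graph :: "nat set set \<Rightarrow> bool" where
  "simple_graph G \<longleftrightarrow> finite G \<and> (\<forall>e\<in>G. card e = 2)"

definition num_edges :: "nat set set \<Rightarrow> nat" where
  "num_edges G = card G"

definition has_cycle :: "nat \<Rightarrow> nat set set \<Rightarrow> bool" where
  "has_cycle t G \<longleftrightarrow> 3 \<le> t \<and> (\<exists>vs :: nat list. length vs = t \<and> distinct vs \<and>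
      (\<forall>i<t. {vs ! i, vs ! ((i + 1) mod t)} \<in> G))"

definition cycle_free :: "nat \<Rightarrow> nat set set \<Rightarrow> bool" where
  "cycle_free t G \<longleftrightarrow> \<not> has_cycle t G"

definition bipartite :: "nat set set \<Rightarrow> bool" where
  "bipartite H \<longleftrightarrow> (\<exists>c :: nat \<Rightarrow> bool. \<forall>e\<in>H. \<forall>u\<in>e. \<forall>v\<in>e. u \<noteq> v \<longrightarrow> c u \<noteq> c v)"

end

theory Submission
  imports Defs "HOL-Library.FuncSet"
begin

text \<open>
  Put \<open>a = k - 1\<close>. The graph is an edge-disjoint union of copies of \<open>K\<^bsub>a,m\<^esub>\<close> on the vertices
  \<open>{..<n}\<close>, added one at a time. Each new copy sits on vertices that are pairwise far apart in the
  current graph, so every \<open>2k\<close>-cycle would lie in a single \<open>K\<^bsub>a,m\<^esub>\<close>, which has none because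
  \<open>a < k\<close>. In a fixed \<open>K\<^bsub>a,m\<^esub>\<close> a \<open>C\<^sub>4\<close>-free subgraph cut by \<open>S\<close> has at most \<open>a\<^sup>2\<close> edges more than
  there are vertices \<open>b\<close> on the \<open>m\<close>-side for which \<open>b\<close> and the \<open>a\<close>-side do not lie on the same side
  of \<open>S\<close>. For a random copy, convexity bounds the expected fraction of such \<open>b\<close> by
  \<open>q = 1 - 2\<^sup>-\<^sup>a\<close>, for every \<open>S\<close>. Instead of choosing copies at random, one
  chooses each copy so that the exponential potential, summed over all \<open>2\<^sup>n\<close> cuts \<open>S\<close>, grows by no
  more than its average factor; since degrees stay bounded, tuples that are not far apart or
  contain a vertex of high degree are too rare to spoil the average. After a large multiple of
  \<open>n\<close> steps no cut has a fraction noticeably above \<open>q\<close>.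
\<close>

section \<open>Balls, blocks and cuts\<close>

definition nbhd :: "nat set set \<Rightarrow> nat \<Rightarrow> nat set" where
  "nbhd G v = {w. {v, w} \<in> G}"

text \<open>The ball of radius \<open>l\<close> around \<open>u\<close>. It contains its centre, so
  a tuple whose entries avoid each other's balls is injective.\<close>

primrec reach :: "nat set set \<Rightarrow> nat \<Rightarrow> nat \<Rightarrow> nat set" where
  "reach G u 0 = {u}"
| "reach G u (Suc l) = reach G u l \<union> (\<Union>v\<in>reach G u l. nbhd G v)"

text \<open>A complete bipartite graph with sides of sizes \<open>a\<close> and \<open>m\<close>
  when \<open>x\<close> is injective on its indices. Arbitrary \<open>x\<close> is allowed so that
  averages can be taken over all functions.\<close>

definition block :: "nat \<Rightarrow> nat \<Rightarrow> (nat \<Rightarrow> nat) \<Rightarrow> nat set set" where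
  "block a m x = (\<lambda>(i, j). {x i, x j}) ` ({..<a} \<times> {a..<a + m})"

text \<open>For \<open>j\<close> on the \<open>m\<close>-side this means that \<open>S\<close> cuts
  none of the block edges at \<open>x j\<close>.\<close>

definition mono_at :: "nat \<Rightarrow> nat set \<Rightarrow> (nat \<Rightarrow> nat) \<Rightarrow> nat \<Rightarrow> bool" where
  "mono_at a S x j \<longleftrightarrow> (\<forall>i\<in>insert j {..<a}. x i \<in> S) \<or> (\<forall>i\<in>insert j {..<a}. x i \<notin> S)"

definition split_frac :: "nat \<Rightarrow> nat \<Rightarrow> nat set \<Rightarrow> (nat \<Rightarrow> nat) \<Rightarrow> real" where
  "split_frac a m S x = real (card {j\<in>{a..<a + m}. \<not> mono_at a S x j}) / real m"

text \<open>Bipartiteness with one colour class named, so that the potential can run over all cuts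
  \<open>S\<close>.\<close>

definition cut_by :: "nat set \<Rightarrow> nat set set \<Rightarrow> bool" where
  "cut_by S H \<longleftrightarrow> (\<forall>e\<in>H. \<forall>u\<in>e. \<forall>v\<in>e. u \<noteq> v \<longrightarrow> (u \<in> S) \<noteq> (v \<in> S))"

lemma cycle_free_mono: "cycle_free t G \<Longrightarrow> H \<subseteq> G \<Longrightarrow> cycle_free t H"
  unfolding cycle_free_def has_cycle_def by blast

section \<open>Degree counts and ball sizes\<close>

lemma finite_nbhd:
  assumes "simple_graph G" shows "finite (nbhd G v)"
proof (rule finite_subset)
  show "nbhd G v \<subseteq> \<Union> G" by (auto simp: nbhd_def)
  show "finite (\<Union> G)"
    using assms unfolding simple_graph_def by (intro finite_Union) (auto intro: card_ge_0_finite)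
qed

text \<open>Double counting of the pairs \<open>(v, w)\<close> with \<open>{v, w} \<in> G\<close>:
  each vertex of high degree starts at least \<open>d\<close> of them, and each edge gives at most
  two.\<close>

lemma card_high_degree:
  assumes G: "simple_graph G"
  shows "card {v\<in>{..<n}. d \<le> card (nbhd G v)} * d \<le> 2 * card G"
proof -
  let ?U = "{v\<in>{..<n}. d \<le> card (nbhd G v)}"
  have finG: "finite G" using G by (simp add: simple_graph_def)
  have two: "finite {(v, w). {v, w} = e} \<and> card {(v, w). {v, w} = e} \<le> 2" if "e \<in> G" for e
  proof -
    have "card e = 2" using that G by (simp add: simple_graph_def)
    then obtain p q where e: "e = {p, q}" by (auto simp: card_2_iff)
    have sub: "{(v, w). {v, w} = e} \<subseteq> set [(p, q), (q, p)]"
      by (auto simp: e doubleton_eq_iff)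
    have "card {(v, w). {v, w} = e} \<le> card (set [(p, q), (q, p)])"
      by (rule card_mono[OF _ sub]) simp
    also have "\<dots> \<le> 2" using card_length[of "[(p, q), (q, p)]"] by simp
    finally show ?thesis using finite_subset[OF sub] by simp
  qed
  have "card ?U * d = (\<Sum>v\<in>?U. d)" by simp
  also have "\<dots> \<le> (\<Sum>v\<in>?U. card (nbhd G v))" by (rule sum_mono) simp
  also have "\<dots> = card (Sigma ?U (nbhd G))"
    by (rule card_SigmaI[symmetric]) (auto simp: finite_nbhd[OF G])
  also have "\<dots> \<le> card (\<Union>e\<in>G. {(v, w). {v, w} = e})"
    by (rule card_mono) (use two finG in \<open>auto simp: nbhd_def\<close>)
  also have "\<dots> \<le> (\<Sum>e\<in>G. card {(v, w). {v, w} = e})"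
    by (rule card_UN_le[OF finG])
  also have "\<dots> \<le> (\<Sum>e\<in>G. 2)" by (rule sum_mono) (rule two[THEN conjunct2])
  finally show ?thesis by simp
qed

lemma finite_reach: "simple_graph G \<Longrightarrow> finite (reach G u l)"
  by (induction l) (auto simp: finite_nbhd)

lemma card_reach_le:
  assumes G: "simple_graph G" and D: "\<And>v. card (nbhd G v) \<le> D"
  shows "card (reach G u l) \<le> (D + 1) ^ l"
proof (induction l)
  case (Suc l)
  let ?R = "reach G u l"
  have fin: "finite ?R" by (rule finite_reach[OF G])
  have "card (\<Union>v\<in>?R. nbhd G v) \<le> (\<Sum>v\<in>?R. card (nbhd G v))"
    by (rule card_UN_le[OF fin])
  also have "\<dots> \<le> (\<Sum>v\<in>?R. D)" by (rule sum_mono) (rule D)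
  finally have "card (\<Union>v\<in>?R. nbhd G v) \<le> card ?R * D" by simp
  then have "card (reach G u (Suc l)) \<le> card ?R + card ?R * D"
    using card_Un_le[of ?R "\<Union>v\<in>?R. nbhd G v"] by simp
  also have "\<dots> = card ?R * (D + 1)" by simp
  also have "\<dots> \<le> (D + 1) ^ l * (D + 1)" using Suc by (rule mult_right_mono) simp
  finally show ?case by (simp add: mult.commute)
qed simp

section \<open>Walks and cycles through added blocks\<close>

lemma reach_mono: "l \<le> l' \<Longrightarrow> reach G u l \<subseteq> reach G u l'"
  by (induction l' rule: dec_induct) auto

lemma reach_walk:
  assumes "\<And>i. i < l \<Longrightarrow> {f i, f (Suc i)} \<in> G"
  shows "f l \<in> reach G (f 0) l"
  using assms
proof (induction l)
  case (Suc l)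
  then have "f l \<in> reach G (f 0) l" "f (Suc l) \<in> nbhd G (f l)"
    by (auto simp: nbhd_def)
  then show ?case by auto
qed simp

text \<open>Every second edge of such a cycle gives \<open>k\<close> pairwise disjoint edges. Each
  meets the \<open>a\<close>-side, which has at most \<open>a < k\<close> vertices.\<close>

lemma block_no_long_cycle:
  assumes a: "a < k"
  shows "cycle_free (2 * k) (block a m x)"
  unfolding cycle_free_def has_cycle_def
proof clarify
  fix vs :: "nat list"
  assume len: "length vs = 2 * k" and dist: "distinct vs"
    and E: "\<forall>i<2 * k. {vs ! i, vs ! ((i + 1) mod (2 * k))} \<in> block a m x"
  have "\<exists>l\<in>{2 * i, 2 * i + 1}. vs ! l \<in> x ` {..<a}" if "i < k" for i
  proof -
    have "{vs ! (2 * i), vs ! (2 * i + 1)} \<in> block a m x"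
      using E[rule_format, of "2 * i"] that by simp
    then show ?thesis by (auto simp: block_def doubleton_eq_iff)
  qed
  then obtain g where g: "\<And>i. i < k \<Longrightarrow> g i \<in> {2 * i, 2 * i + 1} \<and> vs ! g i \<in> x ` {..<a}"
    by metis
  have "inj_on (\<lambda>i. vs ! g i) {..<k}"
  proof (rule inj_onI)
    fix i j assume "i \<in> {..<k}" "j \<in> {..<k}" and eq: "vs ! g i = vs ! g j"
    then have ij: "i < k" "j < k" by auto
    have "g i < length vs" "g j < length vs" using g[OF ij(1)] g[OF ij(2)] ij len by auto
    then have "g i = g j" using eq dist by (simp add: nth_eq_iff_index_eq)
    then show "i = j" using g[OF ij(1)] g[OF ij(2)] by auto
  qed
  then have "card {..<k} \<le> card (x ` {..<a})"
    by (rule card_inj_on_le) (use g in auto)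
  also have "\<dots> \<le> card {..<a}" by (rule card_image_le) simp
  finally show False using a by simp
qed

lemma block_ends: "{u, v} \<in> block a m x \<Longrightarrow> u \<in> x ` {..<a + m} \<and> v \<in> x ` {..<a + m}"
  by (auto simp: block_def doubleton_eq_iff)

text \<open>A \<open>2k\<close>-cycle in the union lies neither in \<open>G\<close> nor in the
  block, so some run of edges outside the block starts and ends at block vertices. This run is a
  walk in \<open>G\<close> with fewer than \<open>2k\<close> edges, so it joins two different block
  vertices that are too close.\<close>

lemma cycle_free_add_block:
  assumes a: "a < k"
    and G: "cycle_free (2 * k) G"
    and far: "\<And>i j. i < a + m \<Longrightarrow> j < a + m \<Longrightarrow> i \<noteq> j \<Longrightarrow> x j \<notin> reach G (x i) (2 * k)"
  shows "cycle_free (2 * k) (G \<union> block a m x)"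
  unfolding cycle_free_def
proof
  let ?t = "2 * k" and ?K = "block a m x"
  assume "has_cycle ?t (G \<union> ?K)"
  then obtain vs where t3: "3 \<le> ?t" and len: "length vs = ?t" and dist: "distinct vs"
    and E: "\<And>i. i < ?t \<Longrightarrow> {vs ! i, vs ! ((i + 1) mod ?t)} \<in> G \<union> ?K"
    unfolding has_cycle_def by blast
  \<comment> \<open>the cycle unrolled to a periodic sequence, so that it can be started anywhere\<close>
  define w where "w i = vs ! (i mod ?t)" for i
  have Ew: "{w i, w (Suc i)} \<in> G \<union> ?K" for i
    using E[of "i mod ?t"] t3 by (simp add: w_def mod_Suc_eq)
  have per: "w (i + ?t) = w i" for i by (simp add: w_def)
  \<comment> \<open>Positions less than a period apart carry different vertices; this separates the
    two ends of the run found below.\<close>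
  have dw: "w i \<noteq> w (i + j)" if "0 < j" "j < ?t" for i j
  proof
    assume "w i = w (i + j)"
    then have "i mod ?t = (i + j) mod ?t"
      using dist len t3 by (simp add: w_def nth_eq_iff_index_eq)
    then have "?t dvd j" using mod_eq_dvd_iff_nat[of i "i + j" ?t] by simp
    then show False using that by (auto dest: dvd_imp_le)
  qed
  have notG: "\<exists>i<?t. {w i, w (Suc i)} \<notin> G"
  proof (rule ccontr)
    assume "\<not> ?thesis"
    then have "has_cycle ?t G"
      unfolding has_cycle_def using t3 len dist by (intro conjI exI[of _ vs]) (auto simp: w_def)
    then show False using G by (simp add: cycle_free_def)
  qed
  have notK: "\<exists>i<?t. {w i, w (Suc i)} \<notin> ?K"
  proof (rule ccontr)
    assume "\<not> ?thesis"
    then have "has_cycle ?t ?K"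
      unfolding has_cycle_def using t3 len dist by (intro conjI exI[of _ vs]) (auto simp: w_def)
    then show False using block_no_long_cycle[OF a] by (simp add: cycle_free_def)
  qed
  obtain i0 where i0: "i0 < ?t" "{w i0, w (Suc i0)} \<notin> G" using notG by blast
  obtain i1 where i1: "i0 < i1" "{w i1, w (Suc i1)} \<notin> ?K"
  proof -
    obtain i where "i < ?t" "{w i, w (Suc i)} \<notin> ?K" using notK by blast
    then have "{w (i + ?t), w (Suc (i + ?t))} \<notin> ?K" "i0 < i + ?t"
      using per[of i] per[of "Suc i"] i0(1) by auto
    then show thesis using that by blast
  qed
  \<comment> \<open>\<open>p\<close> starts a maximal run of edges outside the block, \<open>p + j\<close> ends it\<close>
  define p where "p = (LEAST i. i0 < i \<and> {w i, w (Suc i)} \<notin> ?K)"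
  have p: "i0 < p" "{w p, w (Suc p)} \<notin> ?K"
    using LeastI[of "\<lambda>i. i0 < i \<and> {w i, w (Suc i)} \<notin> ?K" i1] i1 unfolding p_def by auto
  \<comment> \<open>The edge before \<open>p\<close> is either edge \<open>i0\<close>, which is not
    in \<open>G\<close>, or a later one, which is in the block by minimality of
    \<open>p\<close>.\<close>
  have pK: "{w (p - 1), w p} \<in> ?K"
  proof (cases "p - 1 = i0")
    case True
    then show ?thesis using i0(2) Ew[of i0] p(1) by auto
  next
    case False
    then have "i0 < p - 1" "p - 1 < p" using p(1) by auto
    then show ?thesis
      using not_less_Least[of "p - 1" "\<lambda>i. i0 < i \<and> {w i, w (Suc i)} \<notin> ?K"] p(1)
      unfolding p_def[symmetric] by auto
  qed
  \<comment> \<open>The block edge entering \<open>w p\<close> recurs one period later, so the run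
    has at most \<open>?t - 1\<close> edges.\<close>
  have last: "{w (p + (?t - 1)), w (Suc (p + (?t - 1)))} \<in> ?K"
    using pK per[of "p - 1"] per[of p] p(1) t3 by (simp add: algebra_simps)
  define j where "j = (LEAST j. {w (p + j), w (Suc (p + j))} \<in> ?K)"
  have jK: "{w (p + j), w (Suc (p + j))} \<in> ?K"
    unfolding j_def by (rule LeastI, rule last)
  have jt: "j \<le> ?t - 1" unfolding j_def by (rule Least_le, rule last)
  have j0: "0 < j" using p(2) jK by (cases j) auto
  have walk: "{w (p + i), w (p + Suc i)} \<in> G" if "i < j" for i
    using not_less_Least[OF that[unfolded j_def]] Ew[of "p + i"] by auto
  have "w (p + j) \<in> reach G (w (p + 0)) j"
    by (rule reach_walk[where f = "\<lambda>i. w (p + i)"]) (rule walk)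
  then have r: "w (p + j) \<in> reach G (w p) ?t"
    using reach_mono[OF le_trans[OF jt diff_le_self], of G "w p"] by auto
  obtain b where b: "b < a + m" "w p = x b" using block_ends[OF pK] by auto
  obtain c where c: "c < a + m" "w (p + j) = x c" using block_ends[OF jK] by auto
  have "w p \<noteq> w (p + j)" using dw[of j p] j0 jt t3 by auto
  then show False using far[OF b(1) c(1)] r b(2) c(2) by auto
qed

section \<open>Subgraphs of a single block without 4-cycles\<close>

text \<open>A vertex on the \<open>m\<close>-side with an edge in \<open>H\<close> is not
  monochromatic; it pays for one edge. Its further edges are charged to pairs of vertices on the
  \<open>a\<close>-side. No pair is charged by two vertices, since that would close a 4-cycle, so
  the excess is at most \<open>a * a\<close>.\<close>

lemma C4_free_cut_block:
  assumes sub: "H \<subseteq> block a m x" and inj: "inj_on x {..<a + m}"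
    and C4: "cycle_free 4 H" and cut: "cut_by S H"
  shows "card H \<le> card {j\<in>{a..<a + m}. \<not> mono_at a S x j} + a * a"
proof -
  define d where "d j = {i\<in>{..<a}. {x i, x j} \<in> H}" for j
  \<comment> \<open>Pairing the least neighbour with each of the others yields exactly one pair less
    than the degree, and no pair if the degree is zero.\<close>
  define P where "P j = {Min (d j)} \<times> (d j - {Min (d j)})" for j
  let ?B = "{a..<a + m}"
  have fd: "finite (d j)" for j by (simp add: d_def)
  have fP: "finite (P j)" for j by (simp add: P_def fd)
  have deg: "card (d j) \<le> (if mono_at a S x j then 0 else 1) + card (P j)" if j: "j \<in> ?B" for j
  proof (cases "d j = {}")
    case False
    then obtain i where "i \<in> d j" by blast
    then have i: "i < a" "{x i, x j} \<in> H" by (auto simp: d_def)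
    then have "x i \<noteq> x j" using inj_onD[OF inj, of i j] j by auto
    then have "(x i \<in> S) \<noteq> (x j \<in> S)" 
      using cut[unfolded cut_by_def, rule_format, OF i(2), of "x i" "x j"] by simp
    then have "\<not> mono_at a S x j" using i(1) by (auto simp: mono_at_def)
    then show ?thesis using False fd[of j] by (simp add: P_def card_cartesian_product card_Diff_singleton)
  qed simp
  have disj: "P j \<inter> P j' = {}" if "j \<in> ?B" "j' \<in> ?B" "j \<noteq> j'" for j j'
  proof (rule ccontr)
    assume "P j \<inter> P j' \<noteq> {}"
    then obtain i i' where "(i, i') \<in> P j" "(i, i') \<in> P j'" by auto
    moreover from this have "d j \<noteq> {}" "d j' \<noteq> {}" by (auto simp: P_def)
    ultimately have i: "i \<in> d j" "i' \<in> d j" "i \<in> d j'" "i' \<in> d j'" "i \<noteq> i'"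
      using Min_in[OF fd, of j] Min_in[OF fd, of j'] by (auto simp: P_def)
    have "distinct [x i, x j, x i', x j']"
      using i that by (auto simp: d_def inj_on_eq_iff[OF inj])
    moreover have "{x i, x j} \<in> H" "{x j, x i'} \<in> H" "{x i', x j'} \<in> H" "{x j', x i} \<in> H"
      using i by (auto simp: d_def insert_commute[of "x j"] insert_commute[of "x j'"])
    then have "{[x i, x j, x i', x j'] ! l, [x i, x j, x i', x j'] ! ((l + 1) mod 4)} \<in> H"
      if "l < 4" for l
    proof -
      from that have "l = 0 \<or> l = 1 \<or> l = 2 \<or> l = 3" by linarith
      then show ?thesis using \<open>{x i, x j} \<in> H\<close> \<open>{x j, x i'} \<in> H\<close> \<open>{x i', x j'} \<in> H\<close> \<open>{x j', x i} \<in> H\<close>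
        by (elim disjE) simp_all
    qed
    ultimately have "has_cycle 4 H"
      unfolding has_cycle_def by (intro conjI exI[of _ "[x i, x j, x i', x j']"]) auto
    then show False using C4 by (simp add: cycle_free_def)
  qed
  have "H \<subseteq> (\<Union>j\<in>?B. (\<lambda>i. {x i, x j}) ` d j)"
  proof
    fix e assume "e \<in> H"
    moreover then obtain i j where "i < a" "j \<in> ?B" "e = {x i, x j}"
      using sub by (auto simp: block_def)
    ultimately show "e \<in> (\<Union>j\<in>?B. (\<lambda>i. {x i, x j}) ` d j)" by (auto simp: d_def)
  qed
  then have "card H \<le> card (\<Union>j\<in>?B. (\<lambda>i. {x i, x j}) ` d j)"
    by (rule card_mono[rotated]) (auto simp: fd)
  also have "\<dots> \<le> (\<Sum>j\<in>?B. card ((\<lambda>i. {x i, x j}) ` d j))" by (rule card_UN_le) simp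
  also have "\<dots> \<le> (\<Sum>j\<in>?B. (if mono_at a S x j then 0 else 1) + card (P j))"
    by (rule sum_mono) (meson card_image_le deg fd le_trans)
  also have "\<dots> = (\<Sum>j\<in>?B. (if mono_at a S x j then 0 else 1)) + (\<Sum>j\<in>?B. card (P j))"
    by (rule sum.distrib)
  also have "(\<Sum>j\<in>?B. (if mono_at a S x j then 0 else 1)) = card {j\<in>?B. \<not> mono_at a S x j}"
    by (subst sum.If_cases) (auto intro!: arg_cong[of _ _ card])
  also have "(\<Sum>j\<in>?B. card (P j)) = card (\<Union>j\<in>?B. P j)"
    by (rule card_UN_disjoint[symmetric]) (use fP disj in auto)
  also have "card (\<Union>j\<in>?B. P j) \<le> card ({..<a} \<times> {..<a})"
  proof (rule card_mono)
    show "(\<Union>j\<in>?B. P j) \<subseteq> {..<a} \<times> {..<a}"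
    proof
      fix z assume "z \<in> (\<Union>j\<in>?B. P j)"
      then obtain j where z: "z \<in> P j" by blast
      then have "d j \<noteq> {}" by (auto simp: P_def)
      then have "Min (d j) \<in> d j" using fd by simp
      then show "z \<in> {..<a} \<times> {..<a}" using z by (auto simp: P_def d_def)
    qed
  qed simp
  finally show ?thesis by simp
qed

section \<open>Averages over random tuples\<close>

text \<open>Midpoint convexity of the power function. The induction step uses that
  \<open>u - v\<close> and \<open>u ^ k - v ^ k\<close> never have opposite signs.\<close>

lemma two_mult_half_power_le:
  fixes u v :: real
  assumes "0 \<le> u" "0 \<le> v"
  shows "2 * ((u + v) / 2) ^ k \<le> u ^ k + v ^ k"
proof (induction k)
  case (Suc k)
  have "0 \<le> (u - v) * (u ^ k - v ^ k)"
  proof (cases "u \<le> v")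
    case True
    then show ?thesis using power_mono[OF True assms(1), of k] by (intro mult_nonpos_nonpos) auto
  next
    case False
    then show ?thesis using power_mono[of v u k] assms by (intro mult_nonneg_nonneg) auto
  qed
  then have "(u + v) * (u ^ k + v ^ k) \<le> 2 * (u ^ Suc k + v ^ Suc k)"
    by (simp add: algebra_simps)
  moreover have "(u + v) * (2 * ((u + v) / 2) ^ k) \<le> (u + v) * (u ^ k + v ^ k)"
    using Suc assms by (intro mult_left_mono) auto
  ultimately show ?case by simp
qed simp

text \<open>Coordinates in \<open>J\<close> range over \<open>S\<close>, the others over
  \<open>{..<n}\<close>. The factor \<open>n ^ card J\<close> on the left avoids a subtraction in
  the exponent.\<close>

lemma card_funcs_constrained:
  assumes "J \<subseteq> {..<r}" "S \<subseteq> {..<n}"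
  shows "card {x \<in> {..<r} \<rightarrow>\<^sub>E {..<n}. \<forall>i\<in>J. x i \<in> S} * n ^ card J = card S ^ card J * n ^ r"
proof -
  have fJ: "finite J" using assms(1) by (rule finite_subset) simp
  have cJ: "card J \<le> r" using card_mono[OF _ assms(1)] by simp
  have "{x \<in> {..<r} \<rightarrow>\<^sub>E {..<n}. \<forall>i\<in>J. x i \<in> S} = (\<Pi>\<^sub>E i\<in>{..<r}. if i \<in> J then S else {..<n})"
    using assms by (auto simp: PiE_iff extensional_def subset_iff split: if_splits)
  then have "card {x \<in> {..<r} \<rightarrow>\<^sub>E {..<n}. \<forall>i\<in>J. x i \<in> S} = (\<Prod>i<r. if i \<in> J then card S else n)"
    by (simp add: card_PiE if_distrib cong: if_cong)
  also have "\<dots> = card S ^ card ({..<r} \<inter> J) * n ^ card ({..<r} - J)"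
    by (simp add: prod.If_cases Diff_eq)
  also have "\<dots> = card S ^ card J * n ^ (r - card J)"
    using assms(1) fJ by (simp add: Int_absorb1 card_Diff_subset)
  finally show ?thesis using cJ by (simp add: power_add[symmetric])
qed

text \<open>Only an inequality, since \<open>v\<close> and \<open>R\<close> need not lie within
  \<open>{..<n}\<close>.\<close>

lemma card_funcs_two_constrained:
  assumes "i < r" "j < r" "i \<noteq> j" "finite R"
  shows "card {x \<in> {..<r} \<rightarrow>\<^sub>E {..<n}. x i = v \<and> x j \<in> R} * n ^ 2 \<le> card R * n ^ r"
proof -
  let ?Q = "\<lambda>l. if l = i then {v} else if l = j then R else {..<n}"
  have "{x \<in> {..<r} \<rightarrow>\<^sub>E {..<n}. x i = v \<and> x j \<in> R} \<subseteq> (\<Pi>\<^sub>E l\<in>{..<r}. ?Q l)"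
    by (auto simp: PiE_iff extensional_def split: if_splits)
  then have "card {x \<in> {..<r} \<rightarrow>\<^sub>E {..<n}. x i = v \<and> x j \<in> R} \<le> card (\<Pi>\<^sub>E l\<in>{..<r}. ?Q l)"
    by (rule card_mono[rotated]) (use assms in \<open>auto intro!: finite_PiE\<close>)
  also have "\<dots> = (\<Prod>l<r. card (?Q l))" by (simp add: card_PiE)
  also have "\<dots> = card (?Q i) * (card (?Q j) * (\<Prod>l\<in>{..<r} - {i} - {j}. card (?Q l)))"
    using assms by (subst prod.remove[of _ i], simp, simp, subst prod.remove[of _ j]) auto
  also have "(\<Prod>l\<in>{..<r} - {i} - {j}. card (?Q l)) = (\<Prod>l\<in>{..<r} - {i} - {j}. n)"
    by (rule prod.cong) auto
  also have "\<dots> = n ^ (r - 2)" using assms by (simp add: card_Diff_singleton numeral_2_eq_2)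
  finally have "card {x \<in> {..<r} \<rightarrow>\<^sub>E {..<n}. x i = v \<and> x j \<in> R} \<le> card R * n ^ (r - 2)"
    using assms(3) by simp
  then have "card {x \<in> {..<r} \<rightarrow>\<^sub>E {..<n}. x i = v \<and> x j \<in> R} * n ^ 2 \<le> card R * n ^ (r - 2) * n ^ 2"
    by (rule mult_right_mono) simp
  moreover have "r - 2 + 2 = r" using assms by auto
  then have "n ^ (r - 2) * n ^ 2 = n ^ r" by (metis power_add)
  ultimately show ?thesis by (simp add: mult.assoc)
qed

text \<open>A union bound: the first summand covers the \<open>r\<close> events that a coordinate
  has high degree, the second the at most \<open>r\<^sup>2\<close> events that one coordinate falls
  into the ball around another.\<close>

lemma card_bad_tuples_le:
  fixes n r :: nat
  assumes G: "simple_graph G" and n: "0 < n" and D0: "0 < D0"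
    and D: "\<And>v. card (nbhd G v) \<le> D"
  defines "X \<equiv> {..<r} \<rightarrow>\<^sub>E {..<n}"
  shows "real (card {x\<in>X. (\<exists>i<r. D0 \<le> card (nbhd G (x i))) \<or>
      (\<exists>i<r. \<exists>j<r. i \<noteq> j \<and> x j \<in> reach G (x i) L)})
    \<le> (real r * (2 * real (card G)) / (real D0 * real n) + (real r)\<^sup>2 * real ((D + 1) ^ L) / real n)
      * real (card X)"
proof -
  let ?U = "{v\<in>{..<n}. D0 \<le> card (nbhd G v)}" and ?B = "real ((D + 1) ^ L)"
  let ?A1 = "\<lambda>i. {x\<in>X. \<forall>l\<in>{i}. x l \<in> ?U}"
  let ?A2 = "\<lambda>i j v. {x\<in>X. x i = v \<and> x j \<in> reach G v L}"
  let ?P = "{(i, j). i < r \<and> j < r \<and> i \<noteq> j} \<times> {..<n}"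
  let ?N = "real n ^ r"
  have finX: "finite X" by (simp add: X_def finite_PiE)
  have cX: "real (card X) = ?N" by (simp add: X_def card_PiE)
  have finP: "finite ?P"
    by (rule finite_cartesian_product, rule finite_subset[of _ "{..<r} \<times> {..<r}"]) auto
  have cP: "real (card ?P) \<le> (real r)\<^sup>2 * real n"
  proof -
    have "card ?P \<le> card (({..<r} \<times> {..<r}) \<times> {..<n})" by (rule card_mono) auto
    then have "real (card ?P) \<le> real (card (({..<r} \<times> {..<r}) \<times> {..<n}))"
      by (rule of_nat_mono)
    then show ?thesis by (simp add: card_cartesian_product power2_eq_square)
  qed
  have cU: "real (card ?U) \<le> 2 * real (card G) / real D0"
  proof -
    have "real (card ?U * D0) \<le> real (2 * card G)" by (rule of_nat_mono, rule card_high_degree[OF G])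
    then show ?thesis using D0 by (simp add: field_simps)
  qed
  have A1: "real (card (?A1 i)) \<le> 2 * real (card G) / (real D0 * real n) * ?N" if "i < r" for i
  proof -
    have "card (?A1 i) * n = card ?U * n ^ r"
      using card_funcs_constrained[of "{i}" r ?U n] that
      unfolding X_def by (auto simp del: mem_Collect_eq)
    from arg_cong[OF this, of real] have "real (card (?A1 i)) * real n = real (card ?U) * ?N"
      by (simp only: of_nat_mult of_nat_power)
    also have "\<dots> \<le> 2 * real (card G) / real D0 * ?N" by (rule mult_right_mono[OF cU]) simp
    finally show ?thesis using n D0 by (simp add: field_simps)
  qed
  \<comment> \<open>Fixing the value \<open>v\<close> of \<open>x i\<close> turns the ball into a
    fixed set; the union over the \<open>n\<close> values of \<open>v\<close> then cancels one
    factor \<open>n\<close>.\<close>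
  have A2: "real (card (?A2 i j v)) \<le> ?B / (real n)\<^sup>2 * ?N" if "i < r" "j < r" "i \<noteq> j" for i j v
  proof -
    have "card (?A2 i j v) * n ^ 2 \<le> card (reach G v L) * n ^ r"
      unfolding X_def by (rule card_funcs_two_constrained[OF that finite_reach[OF G]])
    also have "\<dots> \<le> (D + 1) ^ L * n ^ r"
      by (rule mult_right_mono[OF card_reach_le[OF G D]]) simp
    finally have "real (card (?A2 i j v) * n ^ 2) \<le> real ((D + 1) ^ L * n ^ r)" by (rule of_nat_mono)
    then show ?thesis using n by (simp add: field_simps)
  qed
  have "{x\<in>X. (\<exists>i<r. D0 \<le> card (nbhd G (x i))) \<or> (\<exists>i<r. \<exists>j<r. i \<noteq> j \<and> x j \<in> reach G (x i) L)}
      \<subseteq> (\<Union>i<r. ?A1 i) \<union> (\<Union>((i, j), v)\<in>?P. ?A2 i j v)"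
    by (auto simp: X_def PiE_iff; blast)
  then have "card {x\<in>X. (\<exists>i<r. D0 \<le> card (nbhd G (x i))) \<or> (\<exists>i<r. \<exists>j<r. i \<noteq> j \<and> x j \<in> reach G (x i) L)}
      \<le> card ((\<Union>i<r. ?A1 i) \<union> (\<Union>((i, j), v)\<in>?P. ?A2 i j v))"
    by (rule card_mono[rotated]) (auto intro!: finite_subset[OF _ finX])
  also have "\<dots> \<le> card (\<Union>i<r. ?A1 i) + card (\<Union>((i, j), v)\<in>?P. ?A2 i j v)"
    by (rule card_Un_le)
  also have "\<dots> \<le> (\<Sum>i<r. card (?A1 i)) + (\<Sum>((i, j), v)\<in>?P. card (?A2 i j v))"
    using card_UN_le[OF finP, of "\<lambda>((i, j), v). ?A2 i j v"] card_UN_le[of "{..<r}" ?A1]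
    by (intro add_mono) (auto simp: case_prod_beta)
  finally have "real (card {x\<in>X. (\<exists>i<r. D0 \<le> card (nbhd G (x i))) \<or> (\<exists>i<r. \<exists>j<r. i \<noteq> j \<and> x j \<in> reach G (x i) L)})
     \<le> (\<Sum>i<r. real (card (?A1 i))) + (\<Sum>((i, j), v)\<in>?P. real (card (?A2 i j v)))"
    by (simp add: case_prod_beta flip: of_nat_sum of_nat_add)
  also have "\<dots> \<le> (\<Sum>i<r. 2 * real (card G) / (real D0 * real n) * ?N) + (\<Sum>p\<in>?P. ?B / (real n)\<^sup>2 * ?N)"
    by (intro add_mono sum_mono) (use A1 A2 in auto)
  also have "\<dots> = real r * (2 * real (card G) / (real D0 * real n) * ?N) + real (card ?P) * (?B / (real n)\<^sup>2 * ?N)"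
    by simp
  also have "\<dots> \<le> real r * (2 * real (card G) / (real D0 * real n) * ?N)
      + ((real r)\<^sup>2 * real n) * (?B / (real n)\<^sup>2 * ?N)"
    by (intro add_left_mono mult_right_mono[OF cP]) simp
  also have "\<dots> = (real r * (2 * real (card G)) / (real D0 * real n) + (real r)\<^sup>2 * ?B / real n) * ?N"
    using n by (simp add: field_simps power2_eq_square)
  finally show ?thesis by (simp only: cX)
qed

text \<open>For fixed \<open>j\<close>, a random tuple has its \<open>a + 1\<close> relevant entries
  all in \<open>S\<close> or all outside with probability
  \<open>p ^ (a + 1) + (1 - p) ^ (a + 1)\<close>, where \<open>p\<close> is the density of
  \<open>S\<close>. By convexity this is at least \<open>1 / 2 ^ a\<close>. Linearity over
  \<open>j\<close> finishes.\<close>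

lemma sum_split_frac_le:
  fixes n m a :: nat
  assumes S: "S \<subseteq> {..<n}" and n: "0 < n" and m: "0 < m"
  defines "X \<equiv> {..<a + m} \<rightarrow>\<^sub>E {..<n}"
  shows "(\<Sum>x\<in>X. split_frac a m S x) \<le> (1 - 1 / 2 ^ a) * real (card X)"
proof -
  let ?B = "{a..<a + m}" and ?N = "real n ^ (a + m)"
  have finX: "finite X" by (simp add: X_def finite_PiE)
  have cX: "real (card X) = ?N" by (simp add: X_def card_PiE)
  have mono: "real (card {x\<in>X. mono_at a S x j}) \<ge> ?N / 2 ^ a" if j: "j \<in> ?B" for j
  proof -
    let ?J = "insert j {..<a}" and ?k = "Suc a"
    let ?M1 = "{x\<in>X. \<forall>i\<in>?J. x i \<in> S}" and ?M2 = "{x\<in>X. \<forall>i\<in>?J. x i \<in> {..<n} - S}"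
    have J: "?J \<subseteq> {..<a + m}" and cJ: "card ?J = ?k" using j by auto
    have "{x\<in>X. mono_at a S x j} = ?M1 \<union> ?M2"
      using J by (auto simp: mono_at_def X_def PiE_iff)
    moreover have "?M1 \<inter> ?M2 = {}" by auto
    ultimately have split: "real (card {x\<in>X. mono_at a S x j}) = real (card ?M1) + real (card ?M2)"
      using finX by (simp add: card_Un_disjoint)
    have "card ?M1 * n ^ ?k = card S ^ ?k * n ^ (a + m)"
      using card_funcs_constrained[OF J S] unfolding cJ X_def .
    from arg_cong[OF this, of real] have 1: "real (card ?M1) * real n ^ ?k = real (card S) ^ ?k * ?N"
      by (simp only: of_nat_mult of_nat_power)
    have "card ?M2 * n ^ ?k = card ({..<n} - S) ^ ?k * n ^ (a + m)"
      using card_funcs_constrained[OF J, of "{..<n} - S" n] unfolding cJ X_def by blast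
    from arg_cong[OF this, of real] have 2: "real (card ?M2) * real n ^ ?k = real (card ({..<n} - S)) ^ ?k * ?N"
      by (simp only: of_nat_mult of_nat_power)
    have sum: "real (card S) + real (card ({..<n} - S)) = real n"
      using S card_mono[OF _ S] by (simp add: card_Diff_subset finite_subset of_nat_diff)
    have "?N / 2 ^ a * real n ^ ?k = 2 * (real n / 2) ^ ?k * ?N"
      by (simp add: power_divide)
    also have "\<dots> \<le> (real (card S) ^ ?k + real (card ({..<n} - S)) ^ ?k) * ?N"
      using two_mult_half_power_le[of "real (card S)" "real (card ({..<n} - S))" ?k]
      unfolding sum by (intro mult_right_mono) auto
    also have "\<dots> = (real (card ?M1) + real (card ?M2)) * real n ^ ?k"
      using 1 2 by (simp add: distrib_right)
    finally have "?N / 2 ^ a * real n ^ ?k \<le> (real (card ?M1) + real (card ?M2)) * real n ^ ?k" .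
    then show ?thesis unfolding split by (rule mult_right_le_imp_le) (use n in simp)
  qed
  have nm: "real (card {x\<in>X. \<not> mono_at a S x j}) \<le> (1 - 1 / 2 ^ a) * ?N" if j: "j \<in> ?B" for j
  proof -
    have "card X = card {x\<in>X. mono_at a S x j} + card {x\<in>X. \<not> mono_at a S x j}"
      using finX by (subst card_Un_disjoint[symmetric]) (auto intro!: arg_cong[of _ _ card])
    then have "?N = real (card {x\<in>X. mono_at a S x j}) + real (card {x\<in>X. \<not> mono_at a S x j})"
      using cX by simp
    moreover have "(1 - 1 / 2 ^ a) * ?N = ?N - ?N / 2 ^ a" by (simp add: left_diff_distrib)
    ultimately show ?thesis using mono[OF j] by linarith
  qed
  have cnt: "real (card {j\<in>?B. \<not> mono_at a S x j}) = (\<Sum>j\<in>?B. of_bool (\<not> mono_at a S x j))" for x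
    by (simp add: sum.If_cases Int_def of_bool_def)
  have "(\<Sum>x\<in>X. split_frac a m S x) = (\<Sum>x\<in>X. \<Sum>j\<in>?B. of_bool (\<not> mono_at a S x j)) / real m"
    unfolding split_frac_def cnt by (rule sum_divide_distrib[symmetric])
  also have "(\<Sum>x\<in>X. \<Sum>j\<in>?B. (of_bool (\<not> mono_at a S x j) :: real))
      = (\<Sum>j\<in>?B. \<Sum>x\<in>X. of_bool (\<not> mono_at a S x j))" by (rule sum.swap)
  also have "\<dots> = (\<Sum>j\<in>?B. real (card {x\<in>X. \<not> mono_at a S x j}))"
    using finX by (simp add: sum.If_cases Int_def of_bool_def)
  also have "\<dots> \<le> (\<Sum>j\<in>?B. (1 - 1 / 2 ^ a) * ?N)" by (rule sum_mono) (rule nm)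
  finally show ?thesis using m by (simp add: cX divide_right_mono)
qed

section \<open>One averaging step for the potential\<close>

text \<open>If every choice in \<open>Y\<close> were heavy, then summing over \<open>Y\<close> would
  exceed the total over \<open>X\<close>. That total is controlled cut by cut through
  \<open>avg\<close>, and passing from \<open>X\<close> to \<open>Y\<close> costs at most a factor
  \<open>exp (2 * \<eta>)\<close>.\<close>

lemma exists_light_step:
  fixes w :: "'c \<Rightarrow> real" and f :: "'c \<Rightarrow> 'x \<Rightarrow> real"
  assumes fin: "finite X" "X \<noteq> {}" "finite C" and Y: "Y \<subseteq> X"
    and bad: "real (card (X - Y)) \<le> \<eta> * real (card X)" and eta: "0 \<le> \<eta>" "\<eta> \<le> 1 / 2"
    and w: "\<And>c. c \<in> C \<Longrightarrow> 0 \<le> w c"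
    and f: "\<And>c x. c \<in> C \<Longrightarrow> x \<in> X \<Longrightarrow> 0 \<le> f c x \<and> f c x \<le> 1"
    and avg: "\<And>c. c \<in> C \<Longrightarrow> (\<Sum>x\<in>X. f c x) \<le> q * real (card X)"
    and lam: "0 \<le> \<theta>" "\<theta> \<le> 1"
  shows "\<exists>x\<in>Y. (\<Sum>c\<in>C. w c * exp (\<theta> * f c x)) \<le> (\<Sum>c\<in>C. w c) * exp (\<theta> * q + \<theta>\<^sup>2 + 2 * \<eta>)"
proof (rule ccontr)
  let ?W = "\<Sum>c\<in>C. w c" and ?N = "real (card X)" and ?e = "exp (\<theta> * q + \<theta>\<^sup>2)"
  assume "\<not> ?thesis"
  then have big: "?W * exp (\<theta> * q + \<theta>\<^sup>2 + 2 * \<eta>) < (\<Sum>c\<in>C. w c * exp (\<theta> * f c x))" if "x \<in> Y" for x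
    using that by (auto simp: not_le)
  have N: "0 < ?N" using fin by (simp add: card_gt_0_iff)
  have W: "0 \<le> ?W" using w by (rule sum_nonneg)
  have finY: "finite Y" using fin(1) Y by (rule finite_subset[rotated])
  have cY: "(1 - \<eta>) * ?N \<le> real (card Y)"
    using bad card_mono[OF fin(1) Y] Y finY by (simp add: card_Diff_subset of_nat_diff algebra_simps)
  have "0 < (1 - \<eta>) * ?N" using N eta by simp
  then have Y0: "Y \<noteq> {}" using cY by auto
  have pt: "exp (\<theta> * f c x) \<le> 1 + \<theta> * f c x + \<theta>\<^sup>2" if "c \<in> C" "x \<in> X" for c x
  proof -
    have "0 \<le> \<theta> * f c x" "\<theta> * f c x \<le> 1" "\<theta> * f c x \<le> \<theta>"
      using f[OF that] lam by (auto intro: mult_nonneg_nonneg mult_le_one mult_left_le)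
    then show ?thesis
      using exp_bound[of "\<theta> * f c x"] power_mono[of "\<theta> * f c x" \<theta> 2] by linarith
  qed
  \<comment> \<open>This is the cost of the excluded tuples: \<open>1 - \<eta>\<close> is at least
    \<open>exp (- 2 * \<eta>)\<close> because \<open>\<eta> \<le> 1 / 2\<close>.\<close>
  have "1 \<le> (1 - \<eta>) * (1 + 2 * \<eta>)"
    using mult_nonneg_nonneg[of \<eta> "1 - 2 * \<eta>"] eta by (simp add: algebra_simps)
  also have "\<dots> \<le> (1 - \<eta>) * exp (2 * \<eta>)"
    using exp_ge_add_one_self[of "2 * \<eta>"] eta by (intro mult_left_mono) auto
  finally have "?W * ?e * ?N * 1 \<le> ?W * ?e * ?N * ((1 - \<eta>) * exp (2 * \<eta>))"
    using W by (intro mult_left_mono) auto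
  also have "\<dots> = ((1 - \<eta>) * ?N) * (?W * exp (\<theta> * q + \<theta>\<^sup>2 + 2 * \<eta>))"
    by (simp add: exp_add)
  also have "\<dots> \<le> real (card Y) * (?W * exp (\<theta> * q + \<theta>\<^sup>2 + 2 * \<eta>))"
    using cY W by (intro mult_right_mono) auto
  also have "\<dots> = (\<Sum>x\<in>Y. ?W * exp (\<theta> * q + \<theta>\<^sup>2 + 2 * \<eta>))" by simp
  also have "\<dots> < (\<Sum>x\<in>Y. \<Sum>c\<in>C. w c * exp (\<theta> * f c x))"
    by (rule sum_strict_mono[OF finY Y0 big])
  also have "\<dots> \<le> (\<Sum>x\<in>X. \<Sum>c\<in>C. w c * exp (\<theta> * f c x))"
    by (rule sum_mono2[OF fin(1) Y]) (simp add: sum_nonneg w)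
  also have "\<dots> = (\<Sum>c\<in>C. \<Sum>x\<in>X. w c * exp (\<theta> * f c x))" by (rule sum.swap)
  also have "\<dots> = (\<Sum>c\<in>C. w c * (\<Sum>x\<in>X. exp (\<theta> * f c x)))" by (simp add: sum_distrib_left)
  also have "\<dots> \<le> (\<Sum>c\<in>C. w c * (?e * ?N))"
  proof (intro sum_mono mult_left_mono)
    fix c assume c: "c \<in> C"
    have "(\<Sum>x\<in>X. exp (\<theta> * f c x)) \<le> (\<Sum>x\<in>X. (1 + \<theta>\<^sup>2) + \<theta> * f c x)"
      by (rule sum_mono) (use pt[OF c] in \<open>simp add: algebra_simps\<close>)
    also have "\<dots> = (1 + \<theta>\<^sup>2) * ?N + \<theta> * (\<Sum>x\<in>X. f c x)"
      by (simp add: sum.distrib sum_distrib_left mult.commute)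
    also have "\<dots> \<le> (1 + \<theta>\<^sup>2) * ?N + \<theta> * (q * ?N)"
      using avg[OF c] lam by (intro add_left_mono mult_left_mono) auto
    also have "\<dots> = (1 + (\<theta> * q + \<theta>\<^sup>2)) * ?N" by (simp add: algebra_simps)
    also have "\<dots> \<le> ?e * ?N" by (intro mult_right_mono exp_ge_add_one_self) simp
    finally show "(\<Sum>x\<in>X. exp (\<theta> * f c x)) \<le> ?e * ?N" .
  qed (use w in auto)
  also have "\<dots> = ?W * ?e * ?N" by (simp add: sum_distrib_right mult.assoc)
  finally show False by simp
qed

section \<open>Greedy addition of blocks\<close>

lemma nbhd_add_block:
  "nbhd (G \<union> block a m x) v \<subseteq> nbhd G v \<union> (if v \<in> x ` {..<a + m} then x ` {..<a + m} else {})"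
  using block_ends[of v _ a m x] by (auto simp: nbhd_def)

text \<open>Only block vertices gain neighbours, at most \<open>a + m\<close> each, and they had
  degree below \<open>D0\<close> before. Hence the same bound survives every step.\<close>

lemma card_nbhd_add_block_le:
  assumes G: "simple_graph G" and D: "card (nbhd G v) \<le> D0 + (a + m)"
    and low: "v \<in> x ` {..<a + m} \<Longrightarrow> card (nbhd G v) < D0"
  shows "card (nbhd (G \<union> block a m x) v) \<le> D0 + (a + m)"
proof (cases "v \<in> x ` {..<a + m}")
  case True
  have "card (nbhd (G \<union> block a m x) v) \<le> card (nbhd G v \<union> x ` {..<a + m})"
    by (rule card_mono) (use nbhd_add_block[of G a m x v] True in \<open>auto simp: finite_nbhd[OF G]\<close>)
  also have "\<dots> \<le> card (nbhd G v) + card (x ` {..<a + m})" by (rule card_Un_le)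
  also have "\<dots> \<le> D0 + (a + m)"
    using low[OF True] card_image_le[of "{..<a + m}" x] by simp
  finally show ?thesis .
next
  case False
  then have "card (nbhd (G \<union> block a m x) v) \<le> card (nbhd G v)"
    by (intro card_mono) (use nbhd_add_block[of G a m x v] in \<open>auto simp: finite_nbhd[OF G]\<close>)
  then show ?thesis using D by simp
qed

lemma card_block:
  assumes inj: "inj_on x {..<a + m}"
  shows "card (block a m x) = a * m"
proof -
  have "inj_on (\<lambda>(i, j). {x i, x j}) ({..<a} \<times> {a..<a + m})"
    by (rule inj_onI) (auto simp: doubleton_eq_iff inj_on_eq_iff[OF inj])
  then show ?thesis by (simp add: block_def card_image card_cartesian_product)
qed

lemma simple_graph_block:
  assumes inj: "inj_on x {..<a + m}"
  shows "simple_graph (block a m x)"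
  by (auto simp: simple_graph_def block_def card_2_iff' inj_on_eq_iff[OF inj])

text \<open>
  \<open>G\<close> arises after \<open>t\<close> greedy steps, and \<open>F S\<close> is the sum of the fractions \<open>split_frac\<close> of the
  cut \<open>S\<close> over these steps. The summand \<open>2 * \<theta>\<^sup>2\<close> in the rate pays for the second-order term of the
  exponential and for the excluded tuples.
\<close>
definition packing ::
  "nat \<Rightarrow> nat \<Rightarrow> nat \<Rightarrow> nat \<Rightarrow> nat \<Rightarrow> real \<Rightarrow> nat \<Rightarrow> nat set set \<Rightarrow> (nat set \<Rightarrow> real) \<Rightarrow> bool" where
  "packing k a m n D0 \<theta> t G F \<longleftrightarrow>
    simple_graph G \<and> \<Union> G \<subseteq> {..<n} \<and> cycle_free (2 * k) G
    \<and> (\<forall>v. card (nbhd G v) \<le> D0 + (a + m)) \<and> card G = t * (a * m)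
    \<and> (\<forall>S H. H \<subseteq> G \<and> cut_by S H \<and> cycle_free 4 H \<longrightarrow>
        real (card H) \<le> real m * F S + real (t * (a * a)))
    \<and> (\<Sum>S\<in>Pow {..<n}. exp (\<theta> * F S)) \<le> 2 ^ n * exp (real t * (\<theta> * (1 - 1 / 2 ^ a) + 2 * \<theta>\<^sup>2))"

text \<open>Induction on the number of blocks. \<open>few_bad\<close> is phrased with the final
  number of edges and the uniform degree bound, so it serves all \<open>M\<close> steps.\<close>

lemma greedy_packing:
  fixes n a m k D0 M :: nat and \<theta> :: real
  assumes a: "0 < a" "a < k" and m: "0 < m" and n: "0 < n" and D0: "0 < D0"
    and th: "0 < \<theta>" "\<theta> \<le> 1"
    and few_bad: "real (a + m) * (2 * real (M * (a * m))) / (real D0 * real n)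
      + (real (a + m))\<^sup>2 * real ((D0 + (a + m) + 1) ^ (2 * k)) / real n \<le> \<theta>\<^sup>2 / 2"
    and t: "t \<le> M"
  shows "\<exists>G F. packing k a m n D0 \<theta> t G F"
  using t
proof (induction t)
  case 0
  have "simple_graph {}" "cycle_free (2 * k) {}"
    using a by (auto simp: simple_graph_def cycle_free_def has_cycle_def intro!: exI[of _ 0])
  then show ?case
    by (intro exI[of _ "{}"] exI[of _ "\<lambda>_. 0"]) (simp add: packing_def nbhd_def card_Pow)
next
  case (Suc t)
  let ?r = "a + m" and ?q = "1 - 1 / 2 ^ a :: real"
  obtain G F where "packing k a m n D0 \<theta> t G F"
    using Suc.IH[OF Suc_leD[OF Suc.prems]] by blast
  then have G: "simple_graph G" and V: "\<Union> G \<subseteq> {..<n}" and C: "cycle_free (2 * k) G"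
    and D: "\<And>v. card (nbhd G v) \<le> D0 + ?r" and cG: "card G = t * (a * m)"
    and H: "\<And>S H. H \<subseteq> G \<Longrightarrow> cut_by S H \<Longrightarrow> cycle_free 4 H \<Longrightarrow>
        real (card H) \<le> real m * F S + real (t * (a * a))"
    and pot: "(\<Sum>S\<in>Pow {..<n}. exp (\<theta> * F S)) \<le> 2 ^ n * exp (real t * (\<theta> * ?q + 2 * \<theta>\<^sup>2))"
    unfolding packing_def by blast+
  define X where "X = {..<?r} \<rightarrow>\<^sub>E {..<n}"
  define Y where "Y = {x\<in>X. (\<forall>i<?r. card (nbhd G (x i)) < D0)
      \<and> (\<forall>i<?r. \<forall>j<?r. i \<noteq> j \<longrightarrow> x j \<notin> reach G (x i) (2 * k))}"
  have bad: "real (card (X - Y)) \<le> \<theta>\<^sup>2 / 2 * real (card X)"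
  proof -
    have "X - Y = {x\<in>X. (\<exists>i<?r. D0 \<le> card (nbhd G (x i))) \<or>
        (\<exists>i<?r. \<exists>j<?r. i \<noteq> j \<and> x j \<in> reach G (x i) (2 * k))}"
      unfolding Y_def by (auto simp: not_less)
    then have "real (card (X - Y)) \<le> (real ?r * (2 * real (card G)) / (real D0 * real n)
        + (real ?r)\<^sup>2 * real ((D0 + ?r + 1) ^ (2 * k)) / real n) * real (card X)"
      using card_bad_tuples_le[OF G n D0 D, of ?r "2 * k"] unfolding X_def by simp
    also have "\<dots> \<le> \<theta>\<^sup>2 / 2 * real (card X)"
    proof (rule mult_right_mono)
      have "real (card G) \<le> real (M * (a * m))"
        unfolding cG using Suc.prems by (intro of_nat_mono mult_right_mono) auto
      then have "real ?r * (2 * real (card G)) / (real D0 * real n)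
          \<le> real ?r * (2 * real (M * (a * m))) / (real D0 * real n)"
        by (intro divide_right_mono mult_left_mono) auto
      then show "real ?r * (2 * real (card G)) / (real D0 * real n)
        + (real ?r)\<^sup>2 * real ((D0 + ?r + 1) ^ (2 * k)) / real n \<le> \<theta>\<^sup>2 / 2"
        using few_bad by linarith
    qed simp
    finally show ?thesis .
  qed
  \<comment> \<open>The weights are the current potential terms. The excluded fraction
    \<open>\<theta>\<^sup>2 / 2\<close> adds one \<open>\<theta>\<^sup>2\<close> to the exponent,
    which yields the rate in \<open>packing\<close>.\<close>
  have "\<exists>x\<in>Y. (\<Sum>S\<in>Pow {..<n}. exp (\<theta> * F S) * exp (\<theta> * split_frac a m S x))
      \<le> (\<Sum>S\<in>Pow {..<n}. exp (\<theta> * F S)) * exp (\<theta> * ?q + \<theta>\<^sup>2 + 2 * (\<theta>\<^sup>2 / 2))"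
  proof (rule exists_light_step[of X _ Y])
    show "finite X" by (simp add: X_def finite_PiE)
    show "X \<noteq> {}" using n by (auto simp: X_def PiE_eq_empty_iff)
    show "Y \<subseteq> X" by (auto simp: Y_def)
    show "\<theta>\<^sup>2 / 2 \<le> 1 / 2" using power_le_one[of \<theta> 2] th by simp
    show "0 \<le> split_frac a m S x \<and> split_frac a m S x \<le> 1" for S x
    proof -
      have "card {j\<in>{a..<a + m}. \<not> mono_at a S x j} \<le> card {a..<a + m}"
        by (rule card_mono) auto
      then show ?thesis using m by (simp add: split_frac_def)
    qed
    show "(\<Sum>x\<in>X. split_frac a m S x) \<le> ?q * real (card X)" if "S \<in> Pow {..<n}" for S
      unfolding X_def by (rule sum_split_frac_le) (use that n m in auto)
  qed (use bad th in auto)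
  then obtain x where x: "x \<in> Y"
    and step: "(\<Sum>S\<in>Pow {..<n}. exp (\<theta> * F S) * exp (\<theta> * split_frac a m S x))
      \<le> (\<Sum>S\<in>Pow {..<n}. exp (\<theta> * F S)) * exp (\<theta> * ?q + \<theta>\<^sup>2 + 2 * (\<theta>\<^sup>2 / 2))" by blast
  have low: "card (nbhd G (x i)) < D0" if "i < ?r" for i using x that by (auto simp: Y_def)
  have far: "x j \<notin> reach G (x i) (2 * k)" if "i < ?r" "j < ?r" "i \<noteq> j" for i j
    using x that by (auto simp: Y_def)
  have xn: "x i < n" if "i < ?r" for i using x that by (auto simp: Y_def X_def PiE_iff)
  have self: "v \<in> reach G v (2 * k)" for v using reach_mono[of 0 "2 * k" G v] by auto
  have inj: "inj_on x {..<?r}"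
    using far self by (intro inj_onI) (metis lessThan_iff)
  let ?K = "block a m x"
  \<comment> \<open>A common edge would put \<open>x j\<close> into the ball of radius 1 around
    \<open>x i\<close>.\<close>
  have disj: "G \<inter> ?K = {}"
  proof (rule ccontr)
    assume "G \<inter> ?K \<noteq> {}"
    then obtain e where e: "e \<in> G" "e \<in> ?K" by blast
    then obtain i j where "i < a" "j \<in> {a..<?r}" "e = {x i, x j}" by (auto simp: block_def)
    with e(1) have ij: "i < a" "j \<in> {a..<?r}" "{x i, x j} \<in> G" by auto
    then have "x j \<in> reach G (x i) 1" by (simp add: nbhd_def)
    then have "x j \<in> reach G (x i) (2 * k)" using reach_mono[of 1 "2 * k" G "x i"] a by auto
    then show False using far[of i j] ij by auto
  qed
  have K: "simple_graph ?K" by (rule simple_graph_block[OF inj])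
  show ?case
    unfolding packing_def
  proof (intro exI[of _ "G \<union> ?K"] exI[of _ "\<lambda>S. F S + split_frac a m S x"] conjI allI impI)
    show "simple_graph (G \<union> ?K)" using G K by (auto simp: simple_graph_def)
    show "\<Union> (G \<union> ?K) \<subseteq> {..<n}" using V xn by (auto simp: block_def)
    show "cycle_free (2 * k) (G \<union> ?K)" by (rule cycle_free_add_block[OF a(2) C far])
    show "card (nbhd (G \<union> ?K) v) \<le> D0 + ?r" for v
      by (rule card_nbhd_add_block_le[OF G D]) (use low in auto)
    show "card (G \<union> ?K) = Suc t * (a * m)"
      using disj G K cG by (simp add: card_Un_disjoint simple_graph_def card_block[OF inj])
    have "(\<Sum>S\<in>Pow {..<n}. exp (\<theta> * (F S + split_frac a m S x)))
        = (\<Sum>S\<in>Pow {..<n}. exp (\<theta> * F S) * exp (\<theta> * split_frac a m S x))"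
      by (simp add: distrib_left exp_add)
    also note step
    also have "(\<Sum>S\<in>Pow {..<n}. exp (\<theta> * F S)) * exp (\<theta> * ?q + \<theta>\<^sup>2 + 2 * (\<theta>\<^sup>2 / 2))
        \<le> 2 ^ n * exp (real t * (\<theta> * ?q + 2 * \<theta>\<^sup>2)) * exp (\<theta> * ?q + \<theta>\<^sup>2 + 2 * (\<theta>\<^sup>2 / 2))"
      by (rule mult_right_mono[OF pot]) simp
    also have "\<dots> = 2 ^ n * exp (real t * (\<theta> * ?q + 2 * \<theta>\<^sup>2) + (\<theta> * ?q + \<theta>\<^sup>2 + 2 * (\<theta>\<^sup>2 / 2)))"
      by (simp only: exp_add mult.assoc)
    also have "real t * (\<theta> * ?q + 2 * \<theta>\<^sup>2) + (\<theta> * ?q + \<theta>\<^sup>2 + 2 * (\<theta>\<^sup>2 / 2))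
        = real (Suc t) * (\<theta> * ?q + 2 * \<theta>\<^sup>2)"
      by (simp add: distrib_right)
    finally show "(\<Sum>S\<in>Pow {..<n}. exp (\<theta> * (F S + split_frac a m S x)))
        \<le> 2 ^ n * exp (real (Suc t) * (\<theta> * ?q + 2 * \<theta>\<^sup>2))" .
  next
    fix S H'
    assume "H' \<subseteq> G \<union> ?K \<and> cut_by S H' \<and> cycle_free 4 H'"
    then have sub: "H' \<subseteq> G \<union> ?K" and cut: "cut_by S H'" and C4: "cycle_free 4 H'" by auto
    have cutI: "cut_by S (H' \<inter> Z)" and C4I: "cycle_free 4 (H' \<inter> Z)" for Z
      using cut cycle_free_mono[OF C4, of "H' \<inter> Z"] by (auto simp: cut_by_def)
    have "H' = (H' \<inter> G) \<union> (H' \<inter> ?K)" using sub by auto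
    then have "card H' \<le> card (H' \<inter> G) + card (H' \<inter> ?K)" by (metis card_Un_le)
    moreover have "card (H' \<inter> ?K) \<le> card {j\<in>{a..<a + m}. \<not> mono_at a S x j} + a * a"
      by (rule C4_free_cut_block[OF _ inj C4I cutI]) simp
    moreover have "real (card (H' \<inter> G)) \<le> real m * F S + real (t * (a * a))"
      by (rule H[OF _ cutI C4I]) simp
    moreover have "real (card {j\<in>{a..<a + m}. \<not> mono_at a S x j}) = real m * split_frac a m S x"
      using m by (simp add: split_frac_def)
    ultimately have "real (card H') \<le> real m * F S + real (t * (a * a))
        + (real m * split_frac a m S x + real (a * a))"
      by linarith
    then show "real (card H') \<le> real m * (F S + split_frac a m S x) + real (Suc t * (a * a))"
      by (simp add: algebra_simps)
  qed
qed

section \<open>Choice of parameters and the final bound\<close>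

theorem theorem4:
  fixes \<epsilon> :: real and k :: nat
  assumes "\<epsilon> > 0" and "k \<ge> 2"
  shows "\<exists>G. simple_graph G \<and> G \<noteq> {} \<and> cycle_free (2 * k) G \<and>
    (\<forall>H. H \<subseteq> G \<and> bipartite H \<and> cycle_free 4 H \<longrightarrow>
       real (num_edges H) \<le> (1 - 1 / 2 ^ (k - 1)) * (1 / real (k - 1)) * real (num_edges G) * (1 + \<epsilon>))"
proof -
  define a where "a = k - 1"
  define q :: real where "q = 1 - 1 / 2 ^ a"
  \<comment> \<open>The final estimate loses \<open>4 * \<theta>\<close>, which must be at most
    \<open>q * \<epsilon>\<close>; since \<open>q \<ge> 1 / 2\<close>, the choice
    \<open>\<epsilon> / 8\<close> suffices.\<close>
  define \<theta> where "\<theta> = min 1 (\<epsilon> / 8)"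
  have a: "0 < a" "a < k" using assms by (auto simp: a_def)
  have th: "0 < \<theta>" "\<theta> \<le> 1" "4 * \<theta> \<le> \<epsilon> / 2" using assms by (auto simp: \<theta>_def)
  have "(2::real) ^ 1 \<le> 2 ^ a" by (rule power_increasing) (use a in auto)
  then have q: "1 / 2 \<le> q" by (simp add: q_def field_simps)
  \<comment> \<open>Large \<open>m\<close> makes the excess \<open>a * a\<close> of each block at
    most a fraction \<open>\<theta>\<close> of \<open>m\<close>.\<close>
  obtain m :: nat where m: "real (a * a) / \<theta> < real m" using reals_Archimedean2 by blast
  then have ma: "real (a * a) \<le> real m * \<theta>" using th by (simp add: field_simps)
  have m0: "0 < m" using m th a by (metis divide_nonneg_pos gr0I not_less of_nat_0 of_nat_0_le_iff)
  \<comment> \<open>With \<open>s * n\<close> blocks, the contribution of the \<open>2 ^ n\<close>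
    cuts is at most \<open>\<theta>\<^sup>2\<close> per block.\<close>
  obtain s :: nat where s: "1 / \<theta>\<^sup>2 < real s" using reals_Archimedean2 by blast
  then have s1: "1 \<le> real s * \<theta>\<^sup>2" using th by (simp add: field_simps)
  have s0: "0 < s" using s1 by (cases s) auto
  let ?r = "a + m"
  \<comment> \<open>The edge count is linear in \<open>n\<close>, so \<open>D0\<close> can make high
    degrees rare independently of \<open>n\<close>. Only then is \<open>n\<close> chosen, large
    against the ball size, which depends on \<open>D0\<close>.\<close>
  obtain D0 :: nat where D0': "8 * real ?r * real s * real (a * m) / \<theta>\<^sup>2 < real D0"
    using reals_Archimedean2 by blast
  have D0: "0 < D0"
    using le_less_trans[OF _ D0', of 0] th by simp
  let ?B = "(real ?r)\<^sup>2 * real ((D0 + ?r + 1) ^ (2 * k))"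
  obtain n :: nat where n': "4 * ?B / \<theta>\<^sup>2 < real n" using reals_Archimedean2 by blast
  have n: "0 < n" using le_less_trans[OF _ n', of 0] th by simp
  define M where "M = s * n"
  have "real ?r * (2 * real (M * (a * m))) / (real D0 * real n) \<le> \<theta>\<^sup>2 / 4"
  proof -
    have "real ?r * (2 * real (M * (a * m))) / (real D0 * real n)
        = 2 * (real ?r * real s * real (a * m)) / real D0"
      using n by (simp add: M_def)
    also have "\<dots> \<le> \<theta>\<^sup>2 / 4"
    proof -
      have "8 * (real ?r * real s * real (a * m)) < real D0 * \<theta>\<^sup>2"
        using D0' th by (simp add: pos_divide_less_eq algebra_simps)
      then show ?thesis using D0 by (simp add: pos_divide_le_eq mult.commute)
    qed
    finally show ?thesis .
  qed
  moreover have "?B / real n \<le> \<theta>\<^sup>2 / 4" using n' n th by (simp add: field_simps)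
  ultimately have few: "real ?r * (2 * real (M * (a * m))) / (real D0 * real n)
      + ?B / real n \<le> \<theta>\<^sup>2 / 2" by linarith
  obtain G F where "packing k a m n D0 \<theta> M G F"
    using greedy_packing[OF a m0 n D0 th(1,2) few order_refl] by blast
  then have G: "simple_graph G" "\<Union> G \<subseteq> {..<n}" "cycle_free (2 * k) G"
    and cG: "card G = M * (a * m)"
    and H: "\<And>S H. H \<subseteq> G \<Longrightarrow> cut_by S H \<Longrightarrow> cycle_free 4 H \<Longrightarrow>
        real (card H) \<le> real m * F S + real (M * (a * a))"
    and pot: "(\<Sum>S\<in>Pow {..<n}. exp (\<theta> * F S)) \<le> 2 ^ n * exp (real M * (\<theta> * q + 2 * \<theta>\<^sup>2))"
    unfolding packing_def q_def by blast+
  \<comment> \<open>One term is at most the whole potential. Taking logarithms, the number of cuts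
    costs \<open>n \<le> M * \<theta>\<^sup>2\<close>, which raises the error from
    \<open>2 * \<theta>\<close> to \<open>3 * \<theta>\<close>.\<close>
  have F: "F S \<le> real M * (q + 3 * \<theta>)" if "S \<in> Pow {..<n}" for S
  proof -
    have "exp (\<theta> * F S) \<le> (\<Sum>S\<in>Pow {..<n}. exp (\<theta> * F S))"
      using member_le_sum[OF that, of "\<lambda>S. exp (\<theta> * F S)"] by simp
    also note pot
    also have "(2::real) ^ n \<le> exp 1 ^ n"
      by (rule power_mono) (use exp_ge_add_one_self[of 1] in auto)
    also have "exp 1 ^ n = exp (real n)" by (simp add: exp_of_nat_mult[symmetric])
    finally have "exp (\<theta> * F S) \<le> exp (real n + real M * (\<theta> * q + 2 * \<theta>\<^sup>2))"
      by (simp add: exp_add mult_right_mono)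
    then have "\<theta> * F S \<le> real n + real M * (\<theta> * q + 2 * \<theta>\<^sup>2)" by simp
    moreover have "real n \<le> real M * \<theta>\<^sup>2"
      using mult_right_mono[OF s1, of "real n"] by (simp add: M_def mult_ac)
    ultimately have "\<theta> * F S \<le> \<theta> * (real M * (q + 3 * \<theta>))"
      by (simp add: algebra_simps power2_eq_square)
    then show ?thesis using th by simp
  qed
  have "G \<noteq> {}" using cG a m0 n s0 by (auto simp: M_def)
  moreover have "real (num_edges H) \<le> q * (1 / real a) * real (num_edges G) * (1 + \<epsilon>)"
    if HG: "H \<subseteq> G" and bip: "bipartite H" and C4: "cycle_free 4 H" for H
  proof -
    obtain c :: "nat \<Rightarrow> bool" where c: "\<forall>e\<in>H. \<forall>u\<in>e. \<forall>v\<in>e. u \<noteq> v \<longrightarrow> c u \<noteq> c v"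
      using bip unfolding bipartite_def by blast
    \<comment> \<open>The colour class is truncated to \<open>{..<n}\<close> so that it is among the
      cuts summed over; all vertices of \<open>G\<close> lie there, so \<open>H\<close> is still
      cut.\<close>
    define S where "S = {v. v < n \<and> c v}"
    have cut: "cut_by S H"
      unfolding cut_by_def
    proof (intro ballI impI)
      fix e u v assume e: "e \<in> H" "u \<in> e" "v \<in> e" "u \<noteq> v"
      then have "u < n" "v < n" using HG G(2) by auto
      then show "(u \<in> S) \<noteq> (v \<in> S)" using c[rule_format, OF e] by (simp add: S_def)
    qed
    have "real (card H) \<le> real m * F S + real (M * (a * a))" by (rule H[OF HG cut C4])
    also have "\<dots> \<le> real m * (real M * (q + 3 * \<theta>)) + real M * (real m * \<theta>)"
      using F[of S] mult_left_mono[OF ma, of "real M"]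
      by (intro add_mono mult_left_mono) (auto simp: S_def)
    also have "\<dots> = real M * real m * (q + 4 * \<theta>)" by (simp add: algebra_simps)
    also have "\<dots> \<le> real M * real m * (q * (1 + \<epsilon>))"
    proof (rule mult_left_mono)
      have "1 / 2 * \<epsilon> \<le> q * \<epsilon>" using q assms(1) by (intro mult_right_mono) auto
      then show "q + 4 * \<theta> \<le> q * (1 + \<epsilon>)" using th(3) by (simp add: distrib_left)
    qed simp
    \<comment> \<open>Each block has \<open>a * m\<close> edges but contributes about
      \<open>q * m\<close> to \<open>H\<close>; this is the source of the factor
      \<open>1 / a\<close>.\<close>
    also have "\<dots> = q * (1 / real a) * real (M * (a * m)) * (1 + \<epsilon>)"
      using a by simp
    finally show ?thesis by (simp add: num_edges_def cG)
  qed
  ultimately show ?thesis using G unfolding q_def a_def by blast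
qed

end
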